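(* Let $A$ be a real $m\times n$ matrix with singular value decomposition $A = U\Sigma V^\top$, let $\tau \ge 0$, and let $A_\tau = U\lfloor \Sigma - \tau I\rfloor_+ V^\top$ be the singular value soft-thresholding of $A$ at level $\tau$. Let $P = \operatorname{polar}(A)$ and $S = \operatorname{polar}(A^\top A - \tau^2 I_n)$. Then $$A_\tau = \tfrac12\,(A + AS) - \tfrac{\tau}{2}\,(P + PS).$$
   Context: All matrices are real. Singular value decompositions are thin: with $k=\min(m,n)$, $A = U\Sigma V^\top$ where $U$ is $m\times k$ and $V$ is $n\times k$ with orthonormal columns, and $\Sigma$ is a $k\times k$ diagonal matrix with nonnegative diagonal entries (the singular values), in nonincreasing order. For a scalar $x$, $\lfloor x\rfloor_+ = \max(x,0)$, and $\lfloor \Sigma-\tau I\rfloor_+$ is the diagonal matrix obtained by applying this function to each diagonal entry of $\Sigma-\tau I$. Equivalently, if $\Sigma = \begin{bmatrix}\Sigma_1 & 0\\ 0&\Sigma_2\end{bmatrix}$ with $\Sigma_1\succeq \tau I\succ \Sigma_2$ and $U=[U_1,U_2]$, $V=[V_1,V_2]$ are partitioned accordingly, then $A_\tau = U_1(\Sigma_1-\tau I)V_1^\top$. For a matrix $M$ with thin singular value decomposition $M = U_M\Sigma_M V_M^\top$, $\operatorname{polar}(M) = U_M V_M^\top$ (the polar factor of $M$). If $M$ is rank deficient, this depends on the choice of singular value decomposition, and $\operatorname{polar}(M)$ denotes the matrix obtained from a chosen one; for $A$ the chosen one is the decomposition $A=U\Sigma V^\top$, so $P=UV^\top$. If $M$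 is symmetric and nonsingular, $\operatorname{polar}(M)$ equals the matrix sign function of $M$ (each eigenvalue is replaced by its sign, with the same eigenvectors). $I_n$ is the $n\times n$ identity matrix. *)

theory Defs
  imports "Jordan_Normal_Form.Matrix" Complex_Main
begin

definition orthonormal_cols :: "real mat \<Rightarrow> bool" where
  "orthonormal_cols U \<longleftrightarrow> transpose_mat U * U = 1\<^sub>m (dim_col U)"

definition thin_svd :: "real mat \<Rightarrow> real mat \<Rightarrow> real mat \<Rightarrow> real mat \<Rightarrow> bool" where
  "thin_svd A U D V \<longleftrightarrow>
    (let m = dim_row A; n = dim_col A; k = min m n in
      U \<in> carrier_mat m k \<and> D \<in> carrier_mat k k \<and> V \<in> carrier_mat n k \<and>
      orthonormal_cols U \<and> orthonormal_cols V \<and>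
      diagonal_mat D \<and>
      (\<forall>i<k. 0 \<le> D $$ (i,i)) \<and>
      (\<forall>i<k. \<forall>j<k. i \<le> j \<longrightarrow> D $$ (j,j) \<le> D $$ (i,i)) \<and>
      A = U * D * transpose_mat V)"

(* The polar factor of M is a function of the singular vectors (U, V) of a chosen thin SVD
   of M; for rank-deficient M it depends on that choice, so the factors are the arguments. *)
definition polar :: "real mat \<Rightarrow> real mat \<Rightarrow> real mat" where
  "polar U V = U * transpose_mat V"

definition diag_pos_part :: "real mat \<Rightarrow> real mat" where
  "diag_pos_part D =
    mat (dim_row D) (dim_col D) (\<lambda>(i,j). if i = j then max (D $$ (i,j)) 0 else 0)"

definition soft_threshold :: "real mat \<Rightarrow> real mat \<Rightarrow> real mat \<Rightarrow> real \<Rightarrow> real mat" where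
  "soft_threshold U D V \<tau> =
    U * diag_pos_part (D - \<tau> \<cdot>\<^sub>m 1\<^sub>m (dim_row D)) * transpose_mat V"

end

(* A - \<tau>P = U(\<Sigma> - \<tau>I)V^T, and the right singular vectors of A are eigenvectors of
   M = A^T A - \<tau>^2 I for the eigenvalues (\<sigma> - \<tau>)(\<sigma> + \<tau>).  The polar factor S of a symmetric
   matrix acts as the sign on eigenvectors with nonzero eigenvalue, whatever singular value
   decomposition is chosen; for \<sigma> = \<tau>, where S is not determined, the factor \<sigma> - \<tau> vanishes.
   So (A - \<tau>P)S = U|\<Sigma> - \<tau>I|V^T, and (x + |x|)/2 = max x 0 concludes. *)
theory Submission
  imports Defs "Jordan_Normal_Form.Determinant"
begin

lemma diagonal_mat_eq_mat_diag:
  assumes "D \<in> carrier_mat n n" "diagonal_mat D"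
  shows "D = mat_diag n (\<lambda>i. D $$ (i,i))"
  using assms by (intro eq_matI) (auto simp: diagonal_mat_def mat_diag_def)

lemma transpose_mat_diag [simp]: "transpose_mat (mat_diag n f) = mat_diag n f"
  by (intro eq_matI) (auto simp: mat_diag_def)

lemma orthonormal_cols_square:
  assumes "W \<in> carrier_mat n n" "orthonormal_cols W"
  shows "W * transpose_mat W = 1\<^sub>m n"
  using assms mat_mult_left_right_inverse[of "transpose_mat W" n W]
  by (auto simp: orthonormal_cols_def)

text \<open>Subtracting the two equations gives \<open>(d + l) * (q - p) = 0\<close>, adding them
  gives \<open>(d - l) * (q + p) = 0\<close>. For \<open>l < 0\<close> the factor
  \<open>d - l\<close> is positive; for \<open>0 \<le> l\<close> the factor \<open>d + l\<close>
  vanishes only if \<open>d = l = 0\<close>, where both sides of the claim are 0.\<close>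

lemma swap_scaled_imp_sign:
  fixes d l p q :: real
  assumes "0 \<le> d" "d * p = l * q" "d * q = l * p"
  shows "l * q = \<bar>l\<bar> * p"
proof (cases "0 \<le> l")
  case True
  have "(d + l) * (q - p) = 0"
    using assms by (simp add: algebra_simps)
  then have "d + l = 0 \<or> q = p" by simp
  with True assms(1) show ?thesis by auto
next
  case False
  have "(d - l) * (q + p) = 0"
    using assms by (simp add: algebra_simps)
  with False assms(1) have "q = - p" by auto
  with False show ?thesis by simp
qed

text \<open>An eigenvector has coordinates \<open>p\<close> and \<open>q\<close> in the right and
  left singular bases, and \<open>M\<close> exchanges them up to scaling: \<open>D * p\<close> is
  \<open>q\<close> times the eigenvalue, and conversely. The factor \<open>mat_diag k l\<close>
  removes eigenvectors in the kernel, where the polar factor depends on the chosen decomposition.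
  There it may even fail to be symmetric, hence the explicit transpose.\<close>

lemma polar_symmetric_eigenvectors:
  assumes M: "M \<in> carrier_mat n n" "transpose_mat M = M"
    and svd: "thin_svd M W D Z"
    and X: "X \<in> carrier_mat n k"
    and eig: "M * X = X * mat_diag k l"
  shows "transpose_mat (polar W Z) * X * mat_diag k l = X * mat_diag k (\<lambda>j. \<bar>l j\<bar>)"
proof -
  define p where "p = transpose_mat Z * X"
  define q where "q = transpose_mat W * X"
  define d where "d = (\<lambda>i. D $$ (i,i))"
  have W: "W \<in> carrier_mat n n" and Z: "Z \<in> carrier_mat n n" and D: "D \<in> carrier_mat n n"
    and oW: "orthonormal_cols W" and oZ: "orthonormal_cols Z" and dD: "diagonal_mat D"
    and nn: "\<And>i. i < n \<Longrightarrow> 0 \<le> d i" and MD: "M = W * D * transpose_mat Z"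
    using svd M(1) by (auto simp: thin_svd_def Let_def d_def)
  have Dd: "D = mat_diag n d"
    unfolding d_def by (rule diagonal_mat_eq_mat_diag[OF D dD])
  have [simp]: "transpose_mat D = D" by (simp add: Dd)
  have WW: "transpose_mat W * W = 1\<^sub>m n" and ZZ: "transpose_mat Z * Z = 1\<^sub>m n"
    using oW oZ W Z by (auto simp: orthonormal_cols_def)
  \<comment> \<open>As \<open>M\<close> is square, its thin factors are square, so orthonormal
    columns make \<open>Z\<close> orthogonal.\<close>
  have ZZ': "Z * transpose_mat Z = 1\<^sub>m n" by (rule orthonormal_cols_square[OF Z oZ])
  \<comment> \<open>Symmetry of \<open>M\<close> yields a second decomposition with the singular
    bases interchanged.\<close>
  have MD': "M = Z * D * transpose_mat W"
  proof -
    have "M = transpose_mat (W * D * transpose_mat Z)" using M(2) MD by simp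
    also have "\<dots> = Z * D * transpose_mat W"
      using W D Z by (simp add: transpose_mult[of _ n n _ n] assoc_mult_mat[of _ n n _ n _ n])
    finally show ?thesis .
  qed
  have p: "p \<in> carrier_mat n k" and q: "q \<in> carrier_mat n k"
    using W Z X by (auto simp: p_def q_def)
  have diag [simp]: "mat_diag r f \<in> carrier_mat r r" for r and f :: "nat \<Rightarrow> real" by simp
  note assoc = assoc_mult_mat[of _ n n _ n _ n] assoc_mult_mat[of _ n n _ n _ k]
    assoc_mult_mat[of _ n n _ k _ k]
  have "D * p = transpose_mat W * (M * X)"
  proof -
    have "transpose_mat W * (M * X) = (transpose_mat W * W) * (D * p)"
      using W Z D X by (simp add: MD p_def assoc)
    then show ?thesis using D p by (simp add: WW)
  qed
  also have "\<dots> = q * mat_diag k l"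
    using W X by (simp add: eig q_def assoc)
  finally have 1: "D * p = q * mat_diag k l" .
  have "D * q = transpose_mat Z * (M * X)"
  proof -
    have "transpose_mat Z * (M * X) = (transpose_mat Z * Z) * (D * q)"
      using W Z D X by (simp add: MD' q_def assoc)
    then show ?thesis using D q by (simp add: ZZ)
  qed
  also have "\<dots> = p * mat_diag k l"
    using Z X by (simp add: eig p_def assoc)
  finally have 2: "D * q = p * mat_diag k l" .
  \<comment> \<open>Entrywise, \<open>1\<close> and \<open>2\<close> are the two scalar equations
    relating the singular value \<open>d i\<close> to the eigenvalue \<open>l j\<close>.\<close>
  have "q * mat_diag k l = p * mat_diag k (\<lambda>j. \<bar>l j\<bar>)"
  proof (rule eq_matI)
    fix i j assume "i < dim_row (p * mat_diag k (\<lambda>j. \<bar>l j\<bar>))"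
      "j < dim_col (p * mat_diag k (\<lambda>j. \<bar>l j\<bar>))"
    then have ij: "i < n" "j < k" using p by (auto simp: mat_diag_def)
    have "d i * p $$ (i,j) = l j * q $$ (i,j)" "d i * q $$ (i,j) = l j * p $$ (i,j)"
      using arg_cong[OF 1, of "\<lambda>B. B $$ (i,j)"] arg_cong[OF 2, of "\<lambda>B. B $$ (i,j)"] ij p q
      by (simp_all add: Dd mat_diag_mult_left[of _ n k] mat_diag_mult_right[of _ n k] mult.commute)
    from swap_scaled_imp_sign[OF nn[OF ij(1)] this]
    show "(q * mat_diag k l) $$ (i,j) = (p * mat_diag k (\<lambda>j. \<bar>l j\<bar>)) $$ (i,j)"
      using ij p q by (simp add: mat_diag_mult_right[of _ n k] mult.commute)
  qed (use p q in \<open>auto simp: mat_diag_def\<close>)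
  then have "Z * (q * mat_diag k l) = Z * (p * mat_diag k (\<lambda>j. \<bar>l j\<bar>))" by simp
  moreover have "Z * (q * mat_diag k l) = transpose_mat (polar W Z) * X * mat_diag k l"
    using W Z X by (simp add: polar_def q_def assoc transpose_mult[of _ n n _ n])
  moreover have "Z * (p * mat_diag k (\<lambda>j. \<bar>l j\<bar>)) = X * mat_diag k (\<lambda>j. \<bar>l j\<bar>)"
  proof -
    have "Z * (p * mat_diag k (\<lambda>j. \<bar>l j\<bar>)) = (Z * transpose_mat Z) * (X * mat_diag k (\<lambda>j. \<bar>l j\<bar>))"
      using Z X by (simp add: p_def assoc)
    then show ?thesis using X by (simp add: ZZ')
  qed
  ultimately show ?thesis by simp
qed

text \<open>Orthonormality collapses \<open>A * V\<close> to \<open>U * mat_diag k s\<close>, and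
  \<open>transpose_mat A\<close> then returns this to \<open>V\<close> with squared singular values.
  For \<open>m < n\<close> the columns of \<open>V\<close> do not span the whole space, so this is
  not a full diagonalization.\<close>

lemma gram_shift_right_singular_vectors:
  fixes s :: "nat \<Rightarrow> real"
  assumes U: "U \<in> carrier_mat m k" "transpose_mat U * U = 1\<^sub>m k"
    and V: "V \<in> carrier_mat n k" "transpose_mat V * V = 1\<^sub>m k"
    and A: "A = U * mat_diag k s * transpose_mat V"
  shows "(transpose_mat A * A - c \<cdot>\<^sub>m 1\<^sub>m n) * V = V * mat_diag k (\<lambda>j. (s j)\<^sup>2 - c)"
proof -
  have diag [simp]: "mat_diag r f \<in> carrier_mat r r" for r and f :: "nat \<Rightarrow> real" by simp
  have Ac: "A \<in> carrier_mat m n"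
    unfolding A using U(1) V(1) by (intro mult_carrier_mat[of _ m k]) auto
  have At: "transpose_mat A = V * (mat_diag k s * transpose_mat U)"
    using U(1) V(1) by (simp add: A transpose_mult[of _ m k _ n] transpose_mult[of _ m k _ k])
  have "A * V = U * mat_diag k s * (transpose_mat V * V)"
    unfolding A using U(1) V(1) by (intro assoc_mult_mat[of _ m k _ n _ k] mult_carrier_mat[of _ m k]) auto
  then have AV: "A * V = U * mat_diag k s" using U(1) V by (simp add: right_mult_one_mat[of _ m k])
  have "transpose_mat A * A * V = transpose_mat A * (U * mat_diag k s)"
    using Ac V(1) by (simp add: assoc_mult_mat[of _ n m _ n _ k] AV)
  also have "\<dots> = V * (mat_diag k s * (transpose_mat U * U * mat_diag k s))"
    using U(1) V(1) mult_carrier_mat[OF diag, of "transpose_mat U" k m s]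
      mult_carrier_mat[OF U(1) diag, of s]
    unfolding At
    by (simp add: assoc_mult_mat[of _ n k _ m _ k] assoc_mult_mat[of _ k k _ m _ k]
        assoc_mult_mat[of _ k m _ k _ k])
  also have "\<dots> = V * mat_diag k (\<lambda>j. (s j)\<^sup>2)"
    by (simp add: U(2) power2_eq_square left_mult_one_mat[OF diag])
  finally have AAV: "transpose_mat A * A * V = V * mat_diag k (\<lambda>j. (s j)\<^sup>2)" .
  have "(transpose_mat A * A - c \<cdot>\<^sub>m 1\<^sub>m n) * V = transpose_mat A * A * V - c \<cdot>\<^sub>m V"
    using Ac V(1) by (simp add: minus_mult_distrib_mat[of _ n n _ _ k] mult_smult_assoc_mat[of _ n n _ k])
  also have "\<dots> = V * mat_diag k (\<lambda>j. (s j)\<^sup>2 - c)"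
    unfolding AAV using V(1)
    by (intro eq_matI) (auto simp: mat_diag_mult_right[of _ n k] algebra_simps)
  finally show ?thesis .
qed

theorem proposition1:
  fixes A U \<Sigma> V U\<^sub>M \<Sigma>\<^sub>M V\<^sub>M A\<^sub>\<tau> P S :: "real mat" and \<tau> :: real and m n :: nat
  assumes "A \<in> carrier_mat m n"
    and "thin_svd A U \<Sigma> V"
    and "\<tau> \<ge> 0"
    and "A\<^sub>\<tau> = soft_threshold U \<Sigma> V \<tau>"
    and "P = polar U V"
    and "thin_svd (transpose_mat A * A - \<tau>\<^sup>2 \<cdot>\<^sub>m 1\<^sub>m n) U\<^sub>M \<Sigma>\<^sub>M V\<^sub>M"
    and "S = polar U\<^sub>M V\<^sub>M"
  shows "A\<^sub>\<tau> = (1 / 2) \<cdot>\<^sub>m (A + A * S) - (\<tau> / 2) \<cdot>\<^sub>m (P + P * S)"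
proof -
  define k where "k = min m n"
  define s where "s = (\<lambda>i. \<Sigma> $$ (i,i))"
  define M where "M = transpose_mat A * A - \<tau>\<^sup>2 \<cdot>\<^sub>m 1\<^sub>m n"
  define e where "e = (\<lambda>j. s j - \<tau>)"
  define l where "l = (\<lambda>j. (s j)\<^sup>2 - \<tau>\<^sup>2)"
  have diag [simp]: "mat_diag r f \<in> carrier_mat r r" for r and f :: "nat \<Rightarrow> real" by simp
  note A = assms(1)
  have U: "U \<in> carrier_mat m k" and D: "\<Sigma> \<in> carrier_mat k k" and V: "V \<in> carrier_mat n k"
    and oU: "transpose_mat U * U = 1\<^sub>m k" and oV: "transpose_mat V * V = 1\<^sub>m k"
    and dD: "diagonal_mat \<Sigma>" and nn: "\<And>i. i < k \<Longrightarrow> 0 \<le> s i"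
    and AD: "A = U * \<Sigma> * transpose_mat V"
    using assms(1,2) by (auto simp: thin_svd_def Let_def s_def k_def orthonormal_cols_def)
  have Ds: "\<Sigma> = mat_diag k s"
    unfolding s_def by (rule diagonal_mat_eq_mat_diag[OF D dD])
  have M: "M \<in> carrier_mat n n" using A by (simp add: M_def minus_carrier_mat)
  have S: "S \<in> carrier_mat n n"
    using assms(6) M by (auto simp: assms(7) polar_def thin_svd_def Let_def M_def[symmetric])
  have P: "P \<in> carrier_mat m n" using U V by (simp add: assms(5) polar_def)
  have "transpose_mat M = M"
  proof -
    have "transpose_mat (transpose_mat A * A) = transpose_mat A * A"
      using A by (simp add: transpose_mult[of _ n m _ n])
    then have "(transpose_mat A * A) $$ (j,i) = (transpose_mat A * A) $$ (i,j)"
      if "i < n" "j < n" for i j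
      using that A by (metis index_transpose_mat(1) index_mult_mat(2,3) index_transpose_mat(2) carrier_matD(2))
    then show ?thesis
      using A by (intro eq_matI) (auto simp: M_def)
  qed
  from polar_symmetric_eigenvectors[OF M this _ V, of U\<^sub>M \<Sigma>\<^sub>M V\<^sub>M l]
  have SV: "transpose_mat S * V * mat_diag k l = V * mat_diag k (\<lambda>j. \<bar>l j\<bar>)"
    using assms(6) gram_shift_right_singular_vectors[OF U oU V oV AD[unfolded Ds], of "\<tau>\<^sup>2"]
    by (simp add: M_def l_def assms(7))
  \<comment> \<open>For \<open>s j = \<tau> = 0\<close> the weight is \<open>1 / 0 = 0\<close>, which is the right value since then \<open>e j = 0\<close>.\<close>
  define c where "c = (\<lambda>j. 1 / (s j + \<tau>))"
  \<comment> \<open>The eigenvalue factors as \<open>l j = e j * (s j + \<tau>)\<close> with a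
    nonnegative second factor, so dividing by that factor respects absolute values.\<close>
  have lc: "l j * c j = e j \<and> \<bar>l j\<bar> * c j = \<bar>e j\<bar>" if "j < k" for j
  proof (cases "s j + \<tau> = 0")
    case True
    then show ?thesis using nn[OF that] assms(3) by (simp add: c_def e_def l_def)
  next
    case False
    then have "0 < s j + \<tau>" using nn[OF that] assms(3) by linarith
    moreover have "l j = e j * (s j + \<tau>)"
      by (simp add: l_def e_def power2_eq_square algebra_simps)
    ultimately show ?thesis by (simp add: c_def abs_mult)
  qed
  have "mat_diag k l * mat_diag k c = mat_diag k e"
    and "mat_diag k (\<lambda>j. \<bar>l j\<bar>) * mat_diag k c = mat_diag k (\<lambda>j. \<bar>e j\<bar>)"
    unfolding mat_diag_diag using lc by (auto simp: mat_diag_def intro!: eq_matI)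
  moreover have "transpose_mat S * V * mat_diag k l * mat_diag k c =
      V * mat_diag k (\<lambda>j. \<bar>l j\<bar>) * mat_diag k c"
    by (simp only: SV)
  moreover have "transpose_mat S * V \<in> carrier_mat n k" using S V by simp
  ultimately have "transpose_mat S * V * mat_diag k e = V * mat_diag k (\<lambda>j. \<bar>e j\<bar>)"
    using V by (simp add: assoc_mult_mat[of _ n k _ k _ k] del: mat_diag_diag)
  \<comment> \<open>Transposing turns the statement about \<open>transpose_mat S\<close> into one
    where \<open>S\<close> acts from the right, as in
    \<open>(A - \<tau> \<cdot>\<^sub>m P) * S\<close>.\<close>
  from arg_cong[OF this, of transpose_mat]
  have VS: "mat_diag k e * (transpose_mat V * S) = mat_diag k (\<lambda>j. \<bar>e j\<bar>) * transpose_mat V"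
    using S V by (simp add: transpose_mult[of _ n k _ k] transpose_mult[of _ n n _ k])
  \<comment> \<open>\<open>P\<close> is built from the same \<open>U\<close> and \<open>V\<close> as
    \<open>A\<close>, so subtracting its multiple shifts each singular value; the entries
    \<open>e j\<close> may be negative.\<close>
  have AP: "A - \<tau> \<cdot>\<^sub>m P = U * mat_diag k e * transpose_mat V"
  proof -
    have "U * mat_diag k e = U * \<Sigma> - \<tau> \<cdot>\<^sub>m U"
      unfolding Ds using U
      by (intro eq_matI) (auto simp: mat_diag_mult_right[of _ m k] e_def algebra_simps)
    then show ?thesis
      using U V D by (simp add: AD assms(5) polar_def minus_mult_distrib_mat[of _ m k _ _ n]
          mult_smult_assoc_mat[of _ m k _ n])
  qed
  have APS: "(A - \<tau> \<cdot>\<^sub>m P) * S = U * mat_diag k (\<lambda>j. \<bar>e j\<bar>) * transpose_mat V"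
    unfolding AP using U V S mult_carrier_mat[OF diag, of "transpose_mat V" k n e]
    by (simp add: assoc_mult_mat[of _ m k _ n _ n] assoc_mult_mat[of _ m k _ k _ n]
        assoc_mult_mat[of _ k k _ n _ n] VS)
  have pos: "diag_pos_part (\<Sigma> - \<tau> \<cdot>\<^sub>m 1\<^sub>m (dim_row \<Sigma>)) =
      (1/2) \<cdot>\<^sub>m (mat_diag k e + mat_diag k (\<lambda>j. \<bar>e j\<bar>))"
    unfolding Ds by (intro eq_matI) (auto simp: diag_pos_part_def mat_diag_def e_def max_def abs_if)
  have "A\<^sub>\<tau> = (1/2) \<cdot>\<^sub>m ((A - \<tau> \<cdot>\<^sub>m P) + (A - \<tau> \<cdot>\<^sub>m P) * S)"
    unfolding assms(4) soft_threshold_def pos APS unfolding AP using U V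
    by (simp add: mult_smult_distrib[of _ m k _ k] mult_add_distrib_mat[of _ m k _ k]
        mult_smult_assoc_mat[of _ m k _ n] add_mult_distrib_mat[of _ m k _ _ n])
  also have "(A - \<tau> \<cdot>\<^sub>m P) * S = A * S - \<tau> \<cdot>\<^sub>m (P * S)"
    using A P S by (simp add: minus_mult_distrib_mat[of _ m n _ _ n] mult_smult_assoc_mat[of _ m n _ n])
  also have "(1/2) \<cdot>\<^sub>m ((A - \<tau> \<cdot>\<^sub>m P) + (A * S - \<tau> \<cdot>\<^sub>m (P * S))) =
      (1 / 2) \<cdot>\<^sub>m (A + A * S) - (\<tau> / 2) \<cdot>\<^sub>m (P + P * S)"
    \<comment> \<open>The identity is linear in \<open>A\<close>, \<open>P\<close>,
      \<open>A * S\<close> and \<open>P * S\<close>, so entries of the two products stay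
      unexpanded.\<close>
    using A P mult_carrier_mat[OF A S] mult_carrier_mat[OF P S]
    by (intro eq_matI) (auto simp: algebra_simps simp del: index_mult_mat(1))
  finally show ?thesis .
qed

end
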